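(* Consider the energy efficiency maximization problem $$\max_{\theta\in\Theta}\ \mathrm{EE}(\theta)=\frac{B_{\mathrm w}\mathrm{ASE}(\theta)}{\mathrm{APC}(\theta)}\quad\text{subject to}\quad\gamma_k(\theta)=\gamma_0,$$ with $\theta=(\zeta,\lambda_{\mathrm{AP}},K,N)$ and $\gamma_0>0$. Let $\{\lambda_{\mathrm{AP}},K,N\}$ be any set of values for which the problem is feasible. Then the optimal pilot reuse factor, satisfying the SINR constraint, is $$\zeta^\star=\frac{\alpha\pi KN\rho_{\mathrm{tr}}\rho_{\mathrm d}-\gamma_0Q_1}{\gamma_0Q_2},$$ where $$Q_1=K\rho_{\mathrm{tr}}\left((\alpha-2)\sum_{j=1}^{K}|\psi_j^H\psi_k|^2+\alpha\pi N\rho_{\mathrm d}(K-1)\left(\sum_{j=1}^{K}|\psi_j^H\psi_k|^2+\lambda_{\mathrm{AP}}\right)\right),$$ $$Q_2=\alpha-1+N\rho_{\mathrm d}(\alpha-2)(K-1).$$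
   Context: Cell-free massive MIMO system: $\zeta$ pilot reuse factor, $\lambda_{\mathrm{AP}}$ access point density, $K$ users, $N$ antennas per access point, $\alpha$ path-loss exponent, $\rho_{\mathrm{tr}},\rho_{\mathrm d}>0$ normalized pilot and downlink powers, $\tau_c$ samples per coherence block, $B_{\mathrm w}$ bandwidth, $S$ area, $\psi_j$ unit-norm pilot of user $j$ with $\psi_j^H\psi_k\in\{0,1\}$; the sum $\sum_{j=1}^K|\psi_j^H\psi_k|^2$ is treated as a fixed quantity. $\Theta=\{\theta:\lambda_{\mathrm{AP}}\ge0,\ \zeta\ge1,\ K/\zeta\le\tau_c,\ K,N\in\mathbb{Z}_+\}$. SINR: $\gamma_k(\theta)=1/\check\gamma_k(\theta)$ with $$\check\gamma_k=\sum_{j=1}^{K}|\psi_j^H\psi_k|^2\left(\frac{\alpha-2}{\alpha\pi N\rho_{\mathrm d}}+K-1\right)+\frac{\zeta}{\alpha\pi K\rho_{\mathrm{tr}}}\left((K-1)(\alpha-2)+\frac{\alpha-1}{N\rho_{\mathrm d}}\right)+\lambda_{\mathrm{AP}}(K-1).$$ $\mathrm{ASE}(\theta)=\frac{K}{S}\left(1-\frac{K}{\zeta\tau_c}\right)\log_2(1+\gamma_k(\theta))$. $\mathrm{APC}(\theta)=\lambda_{\mathrm{AP}}(C_0+C_1K+C_2K^2+D_0N+D_1NK-D_2NK^2)+\mathcal{B}B_{\mathrm w}\mathrm{ASE}(\theta)$, with $C_0=P_{\mathrm{FP}}+P_{\mathrm{LO}}$, $C_1=\frac{B_{\mathrm w}}{7L_{\mathrm{AP}}\tau_c}-\frac{\xi\rho_{\mathrm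 d}}{\alpha_{\mathrm{eff}}\zeta\tau_c}+P_{\mathrm{UE}}$, $C_2=\frac{1}{\alpha_{\mathrm{eff}}\zeta\rho_{\mathrm{tr}}\tau_c}$, $D_0=P_{\mathrm{AP}}$, $D_1=\frac{3B_{\mathrm w}}{L_{\mathrm{AP}}}+\frac{3B_{\mathrm w}}{L_{\mathrm{AP}}\tau_c}$, $D_2=\frac{3B_{\mathrm w}(\xi-1)}{L_{\mathrm{AP}}\zeta\tau_c}$, $\mathcal{B}=P_{\mathrm{COD}}+P_{\mathrm{DEC}}+P_{\mathrm{BT}}$, where the $P$'s, $L_{\mathrm{AP}}$, $\alpha_{\mathrm{eff}}\in(0,1]$ and $\xi\le1$ are fixed hardware/protocol constants. *)

theory Defs
  imports "HOL-Analysis.Analysis"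
begin

text \<open>
  Fixed quantities of a cell-free massive MIMO network.  Users are numbered from 1, and
  \<open>pilot s j\<close> is the pilot of user \<open>j\<close>.  The pilots belong to the fixed data, so that the pilot
  correlation sum below depends on the number of users but not on the pilot reuse factor.
\<close>

record ('p::finite) cf_system =
  alpha :: real        \<comment> \<open>path-loss exponent\<close>
  rho_tr :: real       \<comment> \<open>normalized pilot power\<close>
  rho_d :: real        \<comment> \<open>normalized downlink power\<close>
  tau_c :: real        \<comment> \<open>samples per coherence block\<close>
  B_w :: real          \<comment> \<open>bandwidth\<close>
  area :: real
  P_FP :: real
  P_LO :: real
  P_UE :: real
  P_AP :: real
  P_COD :: real
  P_DEC :: real
  P_BT :: real
  L_AP :: real
  alpha_eff :: real
  xi :: real
  pilot :: "nat \<Rightarrow> complex ^ 'p"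

definition herm_prod :: "complex ^ 'p \<Rightarrow> complex ^ 'p \<Rightarrow> complex" where
  "herm_prod u v = (\<Sum>i\<in>UNIV. cnj (u $ i) * v $ i)"

definition valid_pilots :: "'p::finite cf_system \<Rightarrow> nat \<Rightarrow> bool" where
  "valid_pilots s K \<longleftrightarrow>
     (\<forall>j\<in>{1..K}. norm (pilot s j) = 1) \<and>
     (\<forall>i\<in>{1..K}. \<forall>j\<in>{1..K}. herm_prod (pilot s i) (pilot s j) \<in> {0, 1})"

text \<open>The bound on the path-loss exponent makes the coefficient \<open>Q2\<close> below positive.\<close>

definition valid_system :: "'p::finite cf_system \<Rightarrow> bool" where
  "valid_system s \<longleftrightarrow>
     alpha s \<ge> 2 \<and> rho_tr s > 0 \<and> rho_d s > 0 \<and> tau_c s > 0 \<and> B_w s > 0 \<and> area s > 0 \<and>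
     L_AP s > 0 \<and> 0 < alpha_eff s \<and> alpha_eff s \<le> 1 \<and> xi s \<le> 1"

definition pilot_sum :: "'p::finite cf_system \<Rightarrow> nat \<Rightarrow> nat \<Rightarrow> real" where
  "pilot_sum s k K = (\<Sum>j=1..K. (cmod (herm_prod (pilot s j) (pilot s k)))\<^sup>2)"

text \<open>
  Design variables \<open>(\<zeta>, \<Lambda>, K, N)\<close>: pilot reuse factor, access point density, number of users,
  number of antennas per access point.
\<close>

type_synonym design = "real \<times> real \<times> nat \<times> nat"

definition Theta :: "'p::finite cf_system \<Rightarrow> design set" where
  "Theta s = {(\<zeta>, \<Lambda>, K, N). \<Lambda> \<ge> 0 \<and> \<zeta> \<ge> 1 \<and> real K / \<zeta> \<le> tau_c s \<and> K > 0 \<and> N > 0}"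

fun inv_sinr :: "'p::finite cf_system \<Rightarrow> nat \<Rightarrow> design \<Rightarrow> real" where
  "inv_sinr s k (\<zeta>, \<Lambda>, K, N) =
     pilot_sum s k K * ((alpha s - 2) / (alpha s * pi * real N * rho_d s) + real K - 1)
     + \<zeta> / (alpha s * pi * real K * rho_tr s)
         * ((real K - 1) * (alpha s - 2) + (alpha s - 1) / (real N * rho_d s))
     + \<Lambda> * (real K - 1)"

definition sinr :: "'p::finite cf_system \<Rightarrow> nat \<Rightarrow> design \<Rightarrow> real" where
  "sinr s k \<theta> = 1 / inv_sinr s k \<theta>"

fun ASE :: "'p::finite cf_system \<Rightarrow> nat \<Rightarrow> design \<Rightarrow> real" where
  "ASE s k (\<zeta>, \<Lambda>, K, N) =
     real K / area s * (1 - real K / (\<zeta> * tau_c s)) * log 2 (1 + sinr s k (\<zeta>, \<Lambda>, K, N))"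

definition C0 :: "'p::finite cf_system \<Rightarrow> real" where
  "C0 s = P_FP s + P_LO s"

definition C1 :: "'p::finite cf_system \<Rightarrow> real \<Rightarrow> real" where
  "C1 s \<zeta> = B_w s / (7 * L_AP s * tau_c s)
     - xi s * rho_d s / (alpha_eff s * \<zeta> * tau_c s) + P_UE s"

definition C2 :: "'p::finite cf_system \<Rightarrow> real \<Rightarrow> real" where
  "C2 s \<zeta> = 1 / (alpha_eff s * \<zeta> * rho_tr s * tau_c s)"

definition D0 :: "'p::finite cf_system \<Rightarrow> real" where
  "D0 s = P_AP s"

definition D1 :: "'p::finite cf_system \<Rightarrow> real" where
  "D1 s = 3 * B_w s / L_AP s + 3 * B_w s / (L_AP s * tau_c s)"

definition D2 :: "'p::finite cf_system \<Rightarrow> real \<Rightarrow> real" where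
  "D2 s \<zeta> = 3 * B_w s * (xi s - 1) / (L_AP s * \<zeta> * tau_c s)"

definition B_coef :: "'p::finite cf_system \<Rightarrow> real" where
  "B_coef s = P_COD s + P_DEC s + P_BT s"

fun APC :: "'p::finite cf_system \<Rightarrow> nat \<Rightarrow> design \<Rightarrow> real" where
  "APC s k (\<zeta>, \<Lambda>, K, N) =
     \<Lambda> * (C0 s + C1 s \<zeta> * real K + C2 s \<zeta> * (real K)\<^sup>2
          + D0 s * real N + D1 s * real N * real K - D2 s \<zeta> * real N * (real K)\<^sup>2)
     + B_coef s * B_w s * ASE s k (\<zeta>, \<Lambda>, K, N)"

definition EE :: "'p::finite cf_system \<Rightarrow> nat \<Rightarrow> design \<Rightarrow> real" where
  "EE s k \<theta> = B_w s * ASE s k \<theta> / APC s k \<theta>"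

definition feasible :: "'p::finite cf_system \<Rightarrow> nat \<Rightarrow> real \<Rightarrow> design set" where
  "feasible s k \<gamma>\<^sub>0 = {\<theta> \<in> Theta s. sinr s k \<theta> = \<gamma>\<^sub>0}"

definition Q1 :: "'p::finite cf_system \<Rightarrow> nat \<Rightarrow> real \<Rightarrow> nat \<Rightarrow> nat \<Rightarrow> real" where
  "Q1 s k \<Lambda> K N = real K * rho_tr s *
     ((alpha s - 2) * pilot_sum s k K
      + alpha s * pi * real N * rho_d s * (real K - 1) * (pilot_sum s k K + \<Lambda>))"

definition Q2 :: "'p::finite cf_system \<Rightarrow> nat \<Rightarrow> nat \<Rightarrow> real" where
  "Q2 s K N = alpha s - 1 + real N * rho_d s * (alpha s - 2) * (real K - 1)"

end

theory Submission
  imports Defs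
begin

text \<open>
  The inverse SINR is an affine function of \<open>\<zeta>\<close> with positive slope, so the SINR constraint
  alone determines \<open>\<zeta>\<close>: once \<open>\<Lambda>\<close>, \<open>K\<close> and \<open>N\<close> are fixed, the feasible set is a singleton, and
  its only element is the maximizer of any objective.
\<close>

text \<open>Since \<open>K\<close> is a natural number, \<open>K > 0\<close> gives
  \<open>real K - 1 \<ge> 0\<close>; with \<open>alpha s \<ge> 2\<close> the product term is
  nonnegative and the remaining part is at least 1. This is what permits solving for
  \<zeta>.\<close>

lemma Q2_pos:
  assumes "valid_system s" and "K > 0"
  shows "Q2 s K N > 0"
proof -
  have "0 \<le> real N * rho_d s * (alpha s - 2) * (real K - 1)"
    using assms by (simp add: valid_system_def)
  then show ?thesis
    using assms unfolding Q2_def valid_system_def by linarith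
qed

text \<open>Clearing denominators by the common multiple identifies \<open>Q1\<close> as the scaled
  intercept and \<open>Q2\<close> as the scaled slope in \<zeta>.\<close>

lemma inv_sinr_eq_affine:
  assumes "valid_system s" and "K > 0" and "N > 0"
  shows "inv_sinr s k (\<zeta>, \<Lambda>, K, N) =
    (Q1 s k \<Lambda> K N + \<zeta> * Q2 s K N) / (alpha s * pi * real K * real N * rho_tr s * rho_d s)"
proof -
  have "alpha s \<noteq> 0" "rho_tr s \<noteq> 0" "rho_d s \<noteq> 0"
    using assms(1) by (auto simp: valid_system_def)
  then show ?thesis
    using assms(2,3) by (simp add: Q1_def Q2_def field_simps)
qed

lemma sinr_eq_iff:
  assumes "valid_system s" and "K > 0" and "N > 0" and "\<gamma> > 0"
  shows "sinr s k (\<zeta>, \<Lambda>, K, N) = \<gamma> \<longleftrightarrow>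
    \<zeta> = (alpha s * pi * real K * real N * rho_tr s * rho_d s - \<gamma> * Q1 s k \<Lambda> K N)
        / (\<gamma> * Q2 s K N)"
proof -
  define c where "c = alpha s * pi * real K * real N * rho_tr s * rho_d s"
  have c: "c > 0"
    using assms by (simp add: c_def valid_system_def)
  have q: "Q2 s K N > 0"
    using assms Q2_pos by blast
  have "sinr s k (\<zeta>, \<Lambda>, K, N) = c / (Q1 s k \<Lambda> K N + \<zeta> * Q2 s K N)"
    using inv_sinr_eq_affine[OF assms(1-3)] by (simp add: sinr_def c_def)
  \<comment> \<open>This includes a vanishing denominator: the quotient is then 0 by convention, so
    both sides are false because \<gamma> and \<open>c\<close> are positive.\<close>
  also have "\<dots> = \<gamma> \<longleftrightarrow> c = \<gamma> * (Q1 s k \<Lambda> K N + \<zeta> * Q2 s K N)"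
    using c assms(4) by (auto simp: divide_eq_eq)
  also have "\<dots> \<longleftrightarrow> \<zeta> = (c - \<gamma> * Q1 s k \<Lambda> K N) / (\<gamma> * Q2 s K N)"
    using q assms(4) by (auto simp: eq_divide_eq algebra_simps)
  finally show ?thesis
    by (simp add: c_def)
qed

theorem theorem2:
  fixes s :: "'p::finite cf_system"
    and \<gamma>\<^sub>0 \<Lambda> :: real
    and k K N :: nat
  assumes "valid_system s"
    and "valid_pilots s K"
    and "k \<in> {1..K}"
    and "\<gamma>\<^sub>0 > 0"
    and "\<exists>\<zeta>. (\<zeta>, \<Lambda>, K, N) \<in> feasible s k \<gamma>\<^sub>0"
  shows "\<forall>\<zeta>. is_arg_max (\<lambda>\<zeta>. EE s k (\<zeta>, \<Lambda>, K, N)) (\<lambda>\<zeta>. (\<zeta>, \<Lambda>, K, N) \<in> feasible s k \<gamma>\<^sub>0) \<zeta>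
           \<longleftrightarrow> \<zeta> = (alpha s * pi * real K * real N * rho_tr s * rho_d s - \<gamma>\<^sub>0 * Q1 s k \<Lambda> K N)
                      / (\<gamma>\<^sub>0 * Q2 s K N)"
proof -
  obtain \<zeta>\<^sub>0 where feas: "(\<zeta>\<^sub>0, \<Lambda>, K, N) \<in> feasible s k \<gamma>\<^sub>0"
    using assms(5) by blast
  then have "K > 0" "N > 0"
    by (auto simp: feasible_def Theta_def)
  note sinr_iff = sinr_eq_iff[OF assms(1) this assms(4)]
  \<comment> \<open>Any two feasible values equal the same closed form. That this value satisfies
    the constraints of \<open>Theta\<close> is inherited from the given witness, not computed from
    the formula.\<close>
  have "(\<zeta>, \<Lambda>, K, N) \<in> feasible s k \<gamma>\<^sub>0 \<longleftrightarrow> \<zeta> = \<zeta>\<^sub>0" for \<zeta>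
    using feas sinr_iff by (auto simp: feasible_def)
  then have "is_arg_max (\<lambda>\<zeta>. EE s k (\<zeta>, \<Lambda>, K, N)) (\<lambda>\<zeta>. (\<zeta>, \<Lambda>, K, N) \<in> feasible s k \<gamma>\<^sub>0) \<zeta>
      \<longleftrightarrow> \<zeta> = \<zeta>\<^sub>0" for \<zeta>
    by (auto simp: is_arg_max_def)
  moreover have "\<zeta>\<^sub>0 = (alpha s * pi * real K * real N * rho_tr s * rho_d s
      - \<gamma>\<^sub>0 * Q1 s k \<Lambda> K N) / (\<gamma>\<^sub>0 * Q2 s K N)"
    using feas sinr_iff by (simp add: feasible_def)
  ultimately show ?thesis
    by simp
qed

end
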